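(* Let $0\le\beta<1$, let $n\ge1$ and $k\ge 1$ be integers, and let $r\ge0$ be an integer. Then $$n^2P_{r+2}(k-1;\beta)=n\,[(1-\beta)(k-1)+r+2]\,P_{r+1}(k-1;\beta)+\beta(r+2)(k-1)\,P_r(k-1;\beta).$$
   Context: For $0\le\beta<1$, a positive integer $n$, an integer $k\ge 0$ and $x\in[0,\infty)$, let $$L_{n,k}^{(\beta)}(x)=\frac{nx(nx+k\beta)^{k-1}}{k!}\,e^{-(nx+k\beta)},$$ where for $k=0$ this is understood as $L_{n,0}^{(\beta)}(x)=e^{-nx}$. Write $\langle f,g\rangle=\int_0^\infty f(t)g(t)\,dt$. For integers $r\ge0$ and $k\ge1$, the quantity $P_r(k-1;\beta)$ (which also depends on $n$) is defined by $$P_r(k-1;\beta)=\frac{\langle L_{n,k-1}^{(\beta)}(t),t^r\rangle}{\langle L_{n,k-1}^{(\beta)}(t),1\rangle}.$$ *)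

theory Defs
  imports "HOL-Analysis.Analysis"
begin

(* For k = 0 the exponent k - 1 is -1 and the factor n x cancels; L = exp (- n x) by convention,
   also at x = 0.  In the else branch k >= 1, so the subtraction k - 1 does not truncate. *)
definition L_basis :: "real \<Rightarrow> nat \<Rightarrow> nat \<Rightarrow> real \<Rightarrow> real" where
  "L_basis \<beta> n k x =
     (if k = 0 then exp (- (real n * x))
      else real n * x * (real n * x + real k * \<beta>) ^ (k - 1) / fact k
             * exp (- (real n * x + real k * \<beta>)))"

definition inner_halfline :: "(real \<Rightarrow> real) \<Rightarrow> (real \<Rightarrow> real) \<Rightarrow> real" where
  "inner_halfline f g = (LBINT t:{0..}. f t * g t)"

(* The index j plays the role of k - 1 with k >= 1. *)
definition P_moment :: "nat \<Rightarrow> nat \<Rightarrow> nat \<Rightarrow> real \<Rightarrow> real" where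
  "P_moment n r j \<beta> =
     inner_halfline (L_basis \<beta> n j) (\<lambda>t. t ^ r) / inner_halfline (L_basis \<beta> n j) (\<lambda>t. 1)"

end

theory Submission
  imports Defs "HOL-Probability.Distributions"
begin

text \<open>
  Write \<open>j = k - 1\<close> and let \<open>F x = x ^ (r + 1) * (n x + j \<beta>) * L x\<close>, where \<open>L\<close> is the basis function
  of index \<open>j\<close>. The logarithmic derivative of \<open>L\<close> has the denominator \<open>x (n x + j \<beta>)\<close>, so
  \<open>F'\<close> is again \<open>L\<close> times a polynomial, namely
  \<open>(\<beta> (r + 2) j x ^ r + n ((1 - \<beta>) j + r + 2) x ^ (r + 1) - n\<^sup>2 x ^ (r + 2)) L x\<close>.
  Since \<open>F\<close> vanishes at \<open>0\<close> and at infinity, the integral of \<open>F'\<close> is zero, which is the recurrence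
  up to the normalising factor.
\<close>

text \<open>Expanding one linear factor lowers \<open>p\<close> and leaves two terms of the same
  shape, one with a larger \<open>m\<close>. The inductions on \<open>p\<close> below therefore keep
  \<open>m\<close> arbitrary and reduce to \<open>p = 0\<close>.\<close>

lemma power_mult_linear_power_mult_exp_Suc:
  fixes a c x :: real
  shows "x ^ m * (a * x + c) ^ Suc p * exp (- (a * x)) =
    a * (x ^ Suc m * (a * x + c) ^ p * exp (- (a * x)))
      + c * (x ^ m * (a * x + c) ^ p * exp (- (a * x)))"
  by (simp add: algebra_simps)

lemma set_integrable_power_mult_linear_power_mult_exp:
  fixes a c :: real
  assumes "a > 0"
  shows "set_integrable lborel {0..} (\<lambda>x. x ^ m * (a * x + c) ^ p * exp (- (a * x)))"
proof (induction p arbitrary: m)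
  case 0
  \<comment> \<open>\<open>erlang_density 0 a\<close> is the exponential density a exp(-a x) on the
    half-line, so integrability is finiteness of its \<open>m\<close>-th moment.\<close>
  have "integrable lborel (\<lambda>x. erlang_density 0 a x * x ^ m)"
  proof (rule integrableI_nonneg)
    show "AE x in lborel. 0 \<le> erlang_density 0 a x * x ^ m"
      using assms by (auto simp: erlang_density_def)
    show "(\<integral>\<^sup>+x. ennreal (erlang_density 0 a x * x ^ m) \<partial>lborel) < \<infinity>"
      by (subst nn_integral_erlang_ith_moment[OF assms]) simp
  qed measurable
  then have "integrable lborel (\<lambda>x. erlang_density 0 a x * x ^ m / a)"
    by simp
  also have "(\<lambda>x. erlang_density 0 a x * x ^ m / a) =
      (\<lambda>x. indicator {0..} x *\<^sub>R (x ^ m * (a * x + c) ^ 0 * exp (- (a * x))))"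
    using assms by (auto simp: erlang_density_def indicator_def)
  finally show ?case
    unfolding set_integrable_def .
next
  case (Suc p)
  show ?case
    unfolding power_mult_linear_power_mult_exp_Suc
    by (intro set_integral_add set_integrable_mult_right Suc.IH)
qed

lemma tendsto_power_mult_linear_power_mult_exp:
  fixes a c :: real
  assumes "a > 0"
  shows "((\<lambda>x. x ^ m * (a * x + c) ^ p * exp (- (a * x))) \<longlongrightarrow> 0) at_top"
proof (induction p arbitrary: m)
  case 0
  have "((\<lambda>x. (a * x) ^ m / exp (a * x)) \<longlongrightarrow> 0) at_top"
    by (rule filterlim_compose[OF tendsto_power_div_exp_0])
       (use assms in \<open>simp add: filterlim_tendsto_pos_mult_at_top[OF tendsto_const] filterlim_ident\<close>)
  then have "((\<lambda>x. (1 / a ^ m) * ((a * x) ^ m / exp (a * x))) \<longlongrightarrow> (1 / a ^ m) * 0) at_top"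
    by (intro tendsto_intros)
  also have "(\<lambda>x. (1 / a ^ m) * ((a * x) ^ m / exp (a * x))) =
      (\<lambda>x. x ^ m * (a * x + c) ^ 0 * exp (- (a * x)))"
    using assms by (auto simp: power_mult_distrib exp_minus field_simps)
  finally show ?case by simp
next
  case (Suc p)
  show ?case
    unfolding power_mult_linear_power_mult_exp_Suc
    by (intro tendsto_add_zero tendsto_mult_right_zero Suc.IH)
qed

text \<open>On \<open>{a..b}\<close> the integral is \<open>F b - F a\<close>. Integrability of
  \<open>f\<close> makes these truncated integrals converge to the half-line integral, and limits
  are unique.\<close>

lemma set_integral_FTC_atLeast:
  fixes f F :: "real \<Rightarrow> real"
  assumes deriv: "\<And>x. x \<ge> a \<Longrightarrow> (F has_real_derivative f x) (at x)"
    and cont: "continuous_on {a..} f"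
    and int: "set_integrable lborel {a..} f"
    and lim: "(F \<longlongrightarrow> T) at_top"
  shows "(LBINT x:{a..}. f x) = T - F a"
proof (rule tendsto_unique[OF trivial_limit_at_top_linorder])
  show "((\<lambda>b. LBINT x:{a..b}. f x) \<longlongrightarrow> (LBINT x:{a..}. f x)) at_top"
    by (rule tendsto_set_lebesgue_integral_at_top) (auto intro: int)
  have "(LBINT x:{a..b}. f x) = F b - F a" if "b \<ge> a" for b
    unfolding set_lebesgue_integral_def
  proof (rule integral_FTC_atLeastAtMost[OF that])
    show "(F has_vector_derivative f x) (at x within {a..b})" if "a \<le> x" for x
      using deriv[OF that]
      by (simp add: has_real_derivative_iff_has_vector_derivative has_vector_derivative_at_within)
    show "continuous_on {a..b} f"
      by (rule continuous_on_subset[OF cont]) simp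
  qed
  then have "\<forall>\<^sub>F b in at_top. F b - F a = (LBINT x:{a..b}. f x)"
    by (intro eventually_at_top_linorderI[of a]) simp
  moreover have "((\<lambda>b. F b - F a) \<longlongrightarrow> T - F a) at_top"
    by (intro tendsto_intros lim)
  ultimately show "((\<lambda>b. LBINT x:{a..b}. f x) \<longlongrightarrow> T - F a) at_top"
    by (rule Lim_transform_eventually[rotated])
qed

lemma continuous_on_L_basis: "continuous_on S (L_basis \<beta> n j)"
  unfolding L_basis_def by (cases "j = 0") (simp_all, (intro continuous_intros; simp)+)

text \<open>Pulling out the constant part of the exponential leaves a multiple of the shape treated
  above, with \<open>m = 1\<close> and \<open>p = i\<close>.\<close>

lemma L_basis_Suc:
  "L_basis \<beta> n (Suc i) x = real n * exp (- (real (Suc i) * \<beta>)) / fact (Suc i)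
     * (x * (real n * x + real (Suc i) * \<beta>) ^ i * exp (- (real n * x)))"
proof -
  have "exp (- (real n * x + real (Suc i) * \<beta>)) = exp (- (real (Suc i) * \<beta>)) * exp (- (real n * x))"
    by (simp add: mult_exp_exp del: of_nat_Suc)
  then show ?thesis
    unfolding L_basis_def by (simp del: fact_Suc of_nat_Suc)
qed

lemma set_integrable_L_basis_power:
  assumes "n \<ge> 1"
  shows "set_integrable lborel {0..} (\<lambda>t. L_basis \<beta> n j t * t ^ s)"
proof (cases j)
  case 0
  then show ?thesis
    using set_integrable_power_mult_linear_power_mult_exp[of "real n" s 0 0] assms
    by (simp add: L_basis_def mult.commute)
next
  case (Suc i)
  let ?K = "real n * exp (- (real j * \<beta>)) / fact j"
  have "set_integrable lborel {0..}
      (\<lambda>t. ?K * (t ^ (s + 1) * (real n * t + real j * \<beta>) ^ i * exp (- (real n * t))))"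
    by (intro set_integrable_mult_right set_integrable_power_mult_linear_power_mult_exp)
       (use assms in simp)
  then show ?thesis
    unfolding Suc L_basis_Suc by (simp add: mult_ac del: fact_Suc of_nat_Suc)
qed

text \<open>This is the F of the overview. One \<open>x\<close> and the linear factor clear the
  denominator; the remaining \<open>x ^ r\<close> fixes the lowest moment that occurs.\<close>

definition antideriv :: "real \<Rightarrow> nat \<Rightarrow> nat \<Rightarrow> nat \<Rightarrow> real \<Rightarrow> real" where
  "antideriv \<beta> n j r x = x ^ (r + 1) * (real n * x + real j * \<beta>) * L_basis \<beta> n j x"

lemma tendsto_antideriv:
  assumes "n \<ge> 1"
  shows "(antideriv \<beta> n j r \<longlongrightarrow> 0) at_top"
proof (cases j)
  case 0
  then show ?thesis
    \<comment> \<open>For \<open>j = 0\<close> the linear factor is just \<open>n x\<close>, hence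
      \<open>c = 0\<close> and \<open>p = 1\<close>.\<close>
    using tendsto_power_mult_linear_power_mult_exp[of "real n" "r + 1" 0 1] assms
    by (simp add: antideriv_def[abs_def] L_basis_def)
next
  case (Suc i)
  let ?K = "real n * exp (- (real j * \<beta>)) / fact j"
  have "((\<lambda>x. ?K * (x ^ (r + 2) * (real n * x + real j * \<beta>) ^ Suc i * exp (- (real n * x))))
      \<longlongrightarrow> ?K * 0) at_top"
    by (intro tendsto_mult tendsto_const tendsto_power_mult_linear_power_mult_exp)
       (use assms in simp)
  then show ?thesis
    unfolding antideriv_def[abs_def] Suc L_basis_Suc by (simp add: mult_ac del: fact_Suc of_nat_Suc)
qed

lemma has_real_derivative_antideriv:
  "(antideriv \<beta> n j r has_real_derivative
     \<beta> * (real r + 2) * real j * (L_basis \<beta> n j x * x ^ r)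
     + real n * ((1 - \<beta>) * real j + real r + 2) * (L_basis \<beta> n j x * x ^ (r + 1))
     - (real n)\<^sup>2 * (L_basis \<beta> n j x * x ^ (r + 2))) (at x)"
proof (cases j)
  case 0
  have "((\<lambda>x. real n * (x ^ (r + 2) * exp (- (real n * x)))) has_real_derivative
     real n * ((real r + 2) * x ^ (r + 1) * exp (- (real n * x))
       + x ^ (r + 2) * (exp (- (real n * x)) * - real n))) (at x)"
    by (auto intro!: derivative_eq_intros simp del: power_Suc)
  then show ?thesis
    unfolding antideriv_def[abs_def] 0
    by (simp add: L_basis_def power2_eq_square algebra_simps)
next
  case (Suc i)
  define c where "c = real (Suc i) * \<beta>"
  define K where "K = real n * exp (- c) / fact (Suc i)"
  define E where "E = exp (- (real n * x))"
  define W where "W = (real n * x + c) ^ i"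
  have L: "L_basis \<beta> n j y = K * (y * (real n * y + c) ^ i * exp (- (real n * y)))" for y
    unfolding Suc L_basis_Suc K_def c_def by simp
  have "antideriv \<beta> n j r = (\<lambda>x. K * (x ^ (r + 2) * (real n * x + c) ^ Suc i * exp (- (real n * x))))"
    unfolding antideriv_def[abs_def] L by (simp add: Suc c_def mult_ac del: of_nat_Suc)
  moreover have "((\<lambda>x. K * (x ^ (r + 2) * (real n * x + c) ^ Suc i * exp (- (real n * x))))
      has_real_derivative
      K * ((real r + 2) * x ^ (r + 1) * ((real n * x + c) * W) * E
        + x ^ (r + 2) * (real (Suc i) * W * real n) * E
        + x ^ (r + 2) * ((real n * x + c) * W) * (E * - real n))) (at x)"
    unfolding W_def E_def
    by (auto intro!: derivative_eq_intros simp del: power_Suc of_nat_Suc) (simp add: algebra_simps)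
  \<comment> \<open>Up to the common factor K x^(r+1) W E, the bracket is (r+2)(n x + c) + j n x - n
    x (n x + c), since \<open>j = Suc i\<close>. Collecting powers of x with c = j \<beta> gives the
    three coefficients, and K x W E is \<open>L_basis\<close> at \<open>x\<close>.\<close>
  moreover have "K * ((real r + 2) * x ^ (r + 1) * ((real n * x + c) * W) * E
        + x ^ (r + 2) * (real (Suc i) * W * real n) * E
        + x ^ (r + 2) * ((real n * x + c) * W) * (E * - real n)) =
     \<beta> * (real r + 2) * real j * (L_basis \<beta> n j x * x ^ r)
     + real n * ((1 - \<beta>) * real j + real r + 2) * (L_basis \<beta> n j x * x ^ (r + 1))
     - (real n)\<^sup>2 * (L_basis \<beta> n j x * x ^ (r + 2))"
    unfolding L W_def[symmetric] E_def[symmetric]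
    by (simp add: Suc c_def power2_eq_square algebra_simps)
  ultimately show ?thesis by simp
qed

lemma inner_halfline_L_basis_recurrence:
  fixes \<beta> :: real and n j r :: nat
  assumes "n \<ge> 1"
  defines "M \<equiv> \<lambda>s. inner_halfline (L_basis \<beta> n j) (\<lambda>t. t ^ s)"
  shows "(real n)\<^sup>2 * M (r + 2) = real n * ((1 - \<beta>) * real j + real r + 2) * M (r + 1)
           + \<beta> * (real r + 2) * real j * M r"
proof -
  let ?g = "\<lambda>s t. L_basis \<beta> n j t * t ^ s"
  let ?A = "\<beta> * (real r + 2) * real j" and ?B = "real n * ((1 - \<beta>) * real j + real r + 2)"
  have int: "set_integrable lborel {0..} (\<lambda>t. a * ?g s t)" for a s
    by (intro set_integrable_mult_right set_integrable_L_basis_power assms)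
  have int2: "set_integrable lborel {0..} (\<lambda>t. ?A * ?g r t + ?B * ?g (r + 1) t)"
    by (intro set_integral_add int)
  have "(LBINT t:{0..}. ?A * ?g r t + ?B * ?g (r + 1) t - (real n)\<^sup>2 * ?g (r + 2) t)
      = 0 - antideriv \<beta> n j r 0"
  proof (rule set_integral_FTC_atLeast)
    show "continuous_on {0..} (\<lambda>t. ?A * ?g r t + ?B * ?g (r + 1) t - (real n)\<^sup>2 * ?g (r + 2) t)"
      by (intro continuous_intros continuous_on_L_basis)
    show "set_integrable lborel {0..}
        (\<lambda>t. ?A * ?g r t + ?B * ?g (r + 1) t - (real n)\<^sup>2 * ?g (r + 2) t)"
      by (intro set_integral_diff int int2)
  qed (use assms has_real_derivative_antideriv tendsto_antideriv in auto)
  also have "(LBINT t:{0..}. ?A * ?g r t + ?B * ?g (r + 1) t - (real n)\<^sup>2 * ?g (r + 2) t)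
      = ?A * M r + ?B * M (r + 1) - (real n)\<^sup>2 * M (r + 2)"
    unfolding set_integral_diff(2)[OF int2 int] set_integral_add(2)[OF int int]
      set_integral_mult_right M_def inner_halfline_def ..
  \<comment> \<open>The boundary term at 0 vanishes for every \<open>j\<close> because of the factor
    \<open>x ^ (r + 1)\<close>.\<close>
  finally show ?thesis
    by (simp add: antideriv_def)
qed

theorem lemma3:
  fixes \<beta> :: real and n k r :: nat
  assumes "0 \<le> \<beta>" and "\<beta> < 1" and "n \<ge> 1" and "k \<ge> 1"
  shows "(real n)\<^sup>2 * P_moment n (r + 2) (k - 1) \<beta> =
           real n * ((1 - \<beta>) * (real k - 1) + real r + 2) * P_moment n (r + 1) (k - 1) \<beta>
           + \<beta> * (real r + 2) * (real k - 1) * P_moment n r (k - 1) \<beta>"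
proof -
  \<comment> \<open>The natural subtraction is exact because \<open>k \<ge> 1\<close>.\<close>
  have "real (k - 1) = real k - 1"
    using assms by simp
  \<comment> \<open>All three quotients share the zeroth moment as denominator, so the recurrence
    for the numerators is simply divided by it.\<close>
  then show ?thesis
    using inner_halfline_L_basis_recurrence[OF \<open>n \<ge> 1\<close>, of \<beta> "k - 1" r]
    unfolding P_moment_def times_divide_eq_right add_divide_distrib[symmetric] by simp
qed

end
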